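(* There exist six different pairs of geometric toroidal polyhedra in $\mathbb{R}^3$, all having the same 1-skeleton in $\mathbb{R}^3$, such that in each pair the two polyhedra have no face in common.
   Context: A geometric toroidal polyhedron in $\mathbb{R}^3$ is a geometric realization in $\mathbb{R}^3$ of a triangulation of the 2-torus. Here a triangulation of the 2-torus is an abstract 2-dimensional simplicial complex whose underlying space is homeomorphic to the 2-torus; its faces are its 2-simplices. A geometric realization of it in $\mathbb{R}^3$ represents vertices by points and every simplex by the (nondegenerate) convex hull of its vertices, without self-intersections: any two such geometric simplices intersect exactly in the geometric simplex spanned by their common vertices (or are disjoint if they have no common vertex). The 1-skeleton of such a polyhedron is its set of vertices (points of $\mathbb{R}^3$) and edges (straight segments in $\mathbb{R}^3$). A face is one of the geometric triangles of the polyhedron, and two polyhedra have a common face if some triangle is a face of both. *)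

theory Defs
  imports "HOL-Analysis.Analysis"
begin

text \<open>Only nonempty simplices are recorded, so the vertices are the \<open>v\<close> with \<open>{v} \<in> K\<close>,
  i.e. the elements of \<open>\<Union>K\<close>.\<close>

definition abstract_simplicial_complex :: "'v set set \<Rightarrow> bool" where
  "abstract_simplicial_complex K \<longleftrightarrow>
     finite K \<and>
     (\<forall>\<sigma>\<in>K. finite \<sigma> \<and> \<sigma> \<noteq> {}) \<and>
     (\<forall>\<sigma>\<in>K. \<forall>\<tau>. \<tau> \<subseteq> \<sigma> \<and> \<tau> \<noteq> {} \<longrightarrow> \<tau> \<in> K)"

definition two_dimensional :: "'v set set \<Rightarrow> bool" where
  "two_dimensional K \<longleftrightarrow> (\<forall>\<sigma>\<in>K. card \<sigma> \<le> 3) \<and> (\<exists>\<sigma>\<in>K. card \<sigma> = 3)"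

text \<open>The underlying space in barycentric coordinates. It is topologised as a subset of
  \<open>'v \<Rightarrow> real\<close> with the product topology, which for a finite complex is the usual topology.\<close>

definition underlying_space :: "'v set set \<Rightarrow> ('v \<Rightarrow> real) set" where
  "underlying_space K =
     {t. (\<forall>v. t v \<ge> 0) \<and> {v. t v \<noteq> 0} \<in> K \<and> (\<Sum>v | t v \<noteq> 0. t v) = 1}"

definition torus :: "(complex \<times> complex) set" where
  "torus = sphere 0 1 \<times> sphere 0 1"

definition torus_triangulation :: "'v set set \<Rightarrow> bool" where
  "torus_triangulation K \<longleftrightarrow>
     abstract_simplicial_complex K \<and> two_dimensional K \<and> underlying_space K homeomorphic torus"

text \<open>For \<open>\<sigma> \<inter> \<tau> = {}\<close> the intersection condition says that the two geometric simplices are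
  disjoint; in particular distinct vertices are represented by distinct points.\<close>

definition geometric_realization :: "'v set set \<Rightarrow> ('v \<Rightarrow> real^3) \<Rightarrow> bool" where
  "geometric_realization K \<phi> \<longleftrightarrow>
     (\<forall>\<sigma>\<in>K. inj_on \<phi> \<sigma> \<and> \<not> affine_dependent (\<phi> ` \<sigma>)) \<and>
     (\<forall>\<sigma>\<in>K. \<forall>\<tau>\<in>K.
        convex hull (\<phi> ` \<sigma>) \<inter> convex hull (\<phi> ` \<tau>) = convex hull (\<phi> ` (\<sigma> \<inter> \<tau>)))"

text \<open>A polyhedron is the set of all its geometric simplices (points, segments and triangles).
  Since complexes are finite, taking the abstract vertices from \<open>nat\<close> loses no generality.\<close>

definition geometric_toroidal_polyhedron :: "(real^3) set set \<Rightarrow> bool" where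
  "geometric_toroidal_polyhedron P \<longleftrightarrow>
     (\<exists>(K :: nat set set) \<phi>. torus_triangulation K \<and> geometric_realization K \<phi> \<and>
        P = (\<lambda>\<sigma>. convex hull (\<phi> ` \<sigma>)) ` K)"

text \<open>A vertex \<open>v\<close> occurs in the 1-skeleton as the 0-simplex \<open>{v}\<close>.\<close>

definition one_skeleton :: "(real^3) set set \<Rightarrow> (real^3) set set" where
  "one_skeleton P = {S \<in> P. 0 simplex S \<or> 1 simplex S}"

definition faces :: "(real^3) set set \<Rightarrow> (real^3) set set" where
  "faces P = {S \<in> P. 2 simplex S}"

end

theory Submission
  imports Defs "HOL-Combinatorics.Permutations"
begin

text \<open>
  The boundary of the four-dimensional cross-polytope has 8 vertices in 4 opposite pairs, 24 edges
  (every two vertices that are not opposite) and 32 triangles. Two facts about it give the theorem.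

  Its 2-skeleton contains a torus that passes through all 24 edges and uses 16 of the 32 triangles,
  namely the quotient of the triangular lattice by a sublattice of index 8
  (\<open>cyclic_torus_homeomorphic\<close>). The other 16 triangles span a second copy of the same torus, the
  image of the first one under a symmetry of the cross-polytope (\<open>flip_no_common_triangle\<close>).

  The whole 2-skeleton embeds in \<open>\<real>\<^sup>3\<close> with straight simplices, by the Schlegel diagram that
  shows one tetrahedron inside another (\<open>schlegel_realization\<close>). Hence all tori in it are realized at
  once, and since each of them contains all edges, they all have the same 1-skeleton
  (\<open>one_skeleton_torus_image\<close>).

  Every symmetry of the cross-polytope carries the pair of complementary tori to such a pair. The six
  permutations of three of the four pairs of opposite vertices give six different pairs
  (\<open>inj_on_torus_pair\<close>).
\<close>

section \<open>A torus with eight vertices\<close>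

text \<open>A continuous surjection from a compact space onto a Hausdorff space is a quotient map, so \<open>q\<close>
  descends along \<open>h\<close> to a continuous bijection from \<open>S\<close> to \<open>T\<close>; as \<open>S\<close> is compact, it is a
  homeomorphism.\<close>
lemma homeomorphic_common_quotient:
  fixes q :: "'a::t2_space \<Rightarrow> 'b::t2_space" and h :: "'a \<Rightarrow> 'c::t2_space"
  assumes D: "compact D" and q: "continuous_on D q" "q ` D = T" and h: "continuous_on D h" "h ` D = S"
    and ker: "\<And>x y. x \<in> D \<Longrightarrow> y \<in> D \<Longrightarrow> q x = q y \<longleftrightarrow> h x = h y"
  shows "S homeomorphic T"
proof -
  have quot: "quotient_map (top_of_set D) (top_of_set S) h"
    unfolding quotient_map_def
    using Abstract_Topology_2.continuous_imp_quotient_map[OF h D] h(2) by (auto simp: vimage_def Int_def)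
  have "continuous_map (top_of_set D) (top_of_set T) q"
    using q by auto
  then obtain g where g: "continuous_map (top_of_set S) (top_of_set T) g"
      "g ` topspace (top_of_set S) = q ` topspace (top_of_set D)"
      "\<And>x. x \<in> topspace (top_of_set D) \<Longrightarrow> g (h x) = q x"
    using quotient_map_lift_exists[OF quot, of "top_of_set T" q] ker
    by (metis topspace_euclidean_subtopology)
  show ?thesis
  proof (rule homeomorphic_compact)
    show "compact S"
      using D h compact_continuous_image by metis
    show "continuous_on S g" "g ` S = T"
      using g q by auto
    show "inj_on g S"
      using g(3) ker h(2) by (auto simp: inj_on_def)
  qed
qed

definition residue :: "int \<Rightarrow> nat" where
  "residue i = nat (i mod 8)"

lemma residue_eq_iff: "residue i = residue j \<longleftrightarrow> i mod 8 = j mod 8"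
  unfolding residue_def by (simp add: nat_eq_iff)

lemma residue_of_nat: "v < 8 \<Longrightarrow> residue (int v) = v"
  unfolding residue_def by simp

text \<open>Label the lattice point \<open>(a, b)\<close> of the plane with the residue of \<open>a + 2 * b\<close> modulo 8. A unit
  square whose lower left corner has label \<open>i\<close> has the labels \<open>i + 1\<close> (right), \<open>i + 2\<close> (above) and
  \<open>i + 3\<close> (diagonally opposite) at its other corners. Cutting all unit squares along the diagonals
  from \<open>i\<close> to \<open>i + 3\<close> and identifying lattice points with equal labels yields this complex.\<close>
definition cyclic_torus :: "nat set set" where
  "cyclic_torus = {\<sigma>. \<sigma> \<noteq> {} \<and> (\<exists>i. \<sigma> \<subseteq> {residue i, residue (i + 1), residue (i + 3)} \<or>
                                \<sigma> \<subseteq> {residue i, residue (i + 2), residue (i + 3)})}"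

text \<open>The barycentric coordinates of the point \<open>(f, g)\<close> of the unit square whose lower left corner has
  label \<open>i\<close>. The diagonal divides the square into the triangles \<open>g \<le> f\<close> and \<open>f \<le> g\<close>; the maxima
  and minima combine the two linear expressions.\<close>
definition cell :: "int \<Rightarrow> real \<Rightarrow> real \<Rightarrow> nat \<Rightarrow> real" where
  "cell i f g v =
     (if v = residue i then 1 - max f g
      else if v = residue (i + 1) then max 0 (f - g)
      else if v = residue (i + 2) then max 0 (g - f)
      else if v = residue (i + 3) then min f g else 0)"

lemma residue_distinct:
  "residue i \<noteq> residue (i + 1)" "residue i \<noteq> residue (i + 2)" "residue i \<noteq> residue (i + 3)"
  "residue (i + 1) \<noteq> residue (i + 2)" "residue (i + 1) \<noteq> residue (i + 3)"
  "residue (i + 2) \<noteq> residue (i + 3)"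
  unfolding residue_eq_iff by presburger+

lemma cell_values:
  "cell i f g (residue i) = 1 - max f g"
  "cell i f g (residue (i + 1)) = max 0 (f - g)"
  "cell i f g (residue (i + 2)) = max 0 (g - f)"
  "cell i f g (residue (i + 3)) = min f g"
  using residue_distinct[of i] by (auto simp: cell_def)

lemma cell_outside:
  "v \<notin> {residue i, residue (i + 1), residue (i + 2), residue (i + 3)} \<Longrightarrow> cell i f g v = 0"
  by (simp add: cell_def)

lemma cell_cong: "i mod 8 = j mod 8 \<Longrightarrow> cell i f g = cell j f g"
proof -
  assume "i mod 8 = j mod 8"
  then have "residue (i + k) = residue (j + k)" for k
    unfolding residue_eq_iff by (metis mod_add_left_eq)
  from this[of 0] this[of 1] this[of 2] this[of 3] show ?thesis
    by (simp add: cell_def fun_eq_iff)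
qed

text \<open>The right edge of a square is the left edge of the next square, and the upper edge is the lower edge
  of the square above. The coordinates agree there, which makes the pieces fit together.\<close>
lemma cell_right_edge:
  assumes "0 \<le> g" "g \<le> 1" shows "cell i 1 g = cell (i + 1) 0 g"
proof
  fix v
  have shift: "i + 1 + 1 = i + 2" "i + 1 + 2 = i + 3" by auto
  have vals: "max 1 g = 1" "max 0 g = g" "min 1 g = g" "min 0 g = 0" "max 0 (1 - g) = 1 - g"
    "max 0 (g - 1) = 0" "max 0 (- g) = 0" using assms by auto
  show "cell i 1 g v = cell (i + 1) 0 g v"
    unfolding cell_def shift by (cases "v = residue i") (simp_all add: vals residue_distinct)
qed

lemma cell_top_edge:
  assumes "0 \<le> f" "f \<le> 1" shows "cell i f 1 = cell (i + 2) f 0"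
proof
  fix v
  have shift: "i + 2 + 1 = i + 3" by auto
  have vals: "max f 1 = 1" "max f 0 = f" "min f 1 = f" "min f 0 = 0" "max 0 (1 - f) = 1 - f"
    "max 0 (f - 1) = 0" "max 0 (- f) = 0" "max 0 f = f" using assms by auto
  show "cell i f 1 v = cell (i + 2) f 0 v"
    unfolding cell_def shift
    by (cases "v = residue i"; cases "v = residue (i + 1)") (simp_all add: vals residue_distinct)
qed

text \<open>The covering map from the plane onto the underlying space of the complex.\<close>
definition unroll :: "real \<times> real \<Rightarrow> nat \<Rightarrow> real" where
  "unroll p = cell (\<lfloor>fst p\<rfloor> + 2 * \<lfloor>snd p\<rfloor>) (frac (fst p)) (frac (snd p))"

lemma floor_frac_cases:
  fixes f :: real
  assumes "0 \<le> f" "f \<le> 1"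
  shows "(f < 1 \<and> \<lfloor>of_int a + f\<rfloor> = a \<and> frac (of_int a + f) = f) \<or>
         (f = 1 \<and> \<lfloor>of_int a + f\<rfloor> = a + 1 \<and> frac (of_int a + f) = 0)"
proof (cases "f = 1")
  case True then show ?thesis by (simp add: frac_def)
next
  case False
  then have "\<lfloor>of_int a + f\<rfloor> = a" using assms by (simp add: floor_eq_iff)
  then show ?thesis using False assms by (simp add: frac_def)
qed

text \<open>The formula holds on closed squares, although \<open>unroll\<close> reads a point on the right or upper edge as
  belonging to the neighbouring square. This gives continuity by pasting closed pieces.\<close>
lemma unroll_cell:
  assumes "0 \<le> f" "f \<le> 1" "0 \<le> g" "g \<le> 1"
  shows "unroll (of_int a + f, of_int b + g) = cell (a + 2 * b) f g"
proof -
  have "cell (a + 1 + 2 * b) 0 g = cell (a + 2 * b) 1 g"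
    using cell_right_edge[of g "a + 2 * b"] assms by (simp add: algebra_simps)
  moreover have "cell (a + 2 * (b + 1)) f 0 = cell (a + 2 * b) f 1"
    using cell_top_edge[of f "a + 2 * b"] assms by (simp add: algebra_simps)
  moreover have "cell (a + 1 + 2 * (b + 1)) 0 0 = cell (a + 2 * b) 1 1"
    using cell_right_edge[of 1 "a + 2 * b"] cell_top_edge[of 0 "a + 1 + 2 * b"]
    by (simp add: algebra_simps)
  ultimately show ?thesis
    using floor_frac_cases[OF assms(1,2), of a] floor_frac_cases[OF assms(3,4), of b]
    unfolding unroll_def by auto
qed

text \<open>A row of eight unit squares is a fundamental domain of the lattice of label-preserving
  translations.\<close>
abbreviation strip :: "(real \<times> real) set" where
  "strip \<equiv> {0..8} \<times> {0..1}"

lemma continuous_on_unroll: "continuous_on strip unroll"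
proof -
  have square: "continuous_on ({real_of_int a..real_of_int a + 1} \<times> {0..1}) unroll" for a
  proof -
    have "continuous_on ({real_of_int a..real_of_int a + 1} \<times> {0..1})
            (\<lambda>p. cell a (fst p - of_int a) (snd p))"
    proof (rule continuous_on_coordinatewise_then_product)
      fix v
      show "continuous_on ({real_of_int a..real_of_int a + 1} \<times> {0..1})
              (\<lambda>p. cell a (fst p - of_int a) (snd p) v)"
        unfolding cell_def by (cases "v = residue a"; cases "v = residue (a + 1)";
            cases "v = residue (a + 2)"; cases "v = residue (a + 3)")
          (auto simp del: max.bounded_iff intro!: continuous_intros)
    qed
    moreover have "unroll p = cell a (fst p - of_int a) (snd p)"
      if "p \<in> {real_of_int a..real_of_int a + 1} \<times> {0..1}" for p
      using that unroll_cell[of "fst p - of_int a" "snd p" a 0] by auto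
    ultimately show ?thesis
      by (metis (no_types, lifting) continuous_on_cong)
  qed
  have "strip \<subseteq> (\<Union>a\<in>{0..7}. {real_of_int a..real_of_int a + 1} \<times> {0..1})"
  proof
    fix p assume p: "p \<in> strip"
    show "p \<in> (\<Union>a\<in>{0..7}. {real_of_int a..real_of_int a + 1} \<times> {0..1})"
    proof (cases "fst p = 8")
      case True then show ?thesis using p by (auto intro!: bexI[of _ 7])
    next
      case False
      then have "\<lfloor>fst p\<rfloor> \<in> {0..7}" using p by (auto; linarith)
      moreover have "fst p \<in> {real_of_int \<lfloor>fst p\<rfloor>..real_of_int \<lfloor>fst p\<rfloor> + 1}"
        by auto
      ultimately show ?thesis using p by (intro UN_I[of "\<lfloor>fst p\<rfloor>"]) (auto simp: mem_Times_iff)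
    qed
  qed
  moreover have "continuous_on (\<Union>a\<in>{0..7}. {real_of_int a..real_of_int a + 1} \<times> {0..1}) unroll"
    by (intro continuous_on_closed_Union square closed_Times) auto
  ultimately show ?thesis
    using continuous_on_subset by blast
qed

text \<open>The translations preserving labels form the lattice spanned by \<open>(8, 0)\<close> and \<open>(-2, 1)\<close>. The
  functions \<open>(x + 2 * y) / 8\<close> and \<open>y\<close> are the coordinates with respect to this basis, so that
  \<open>winding\<close> is the quotient map from the plane onto the standard torus.\<close>
definition winding :: "real \<times> real \<Rightarrow> complex \<times> complex" where
  "winding p = (cis (2 * pi * ((fst p + 2 * snd p) / 8)), cis (2 * pi * snd p))"

lemma cis_2pi_eq_iff: "cis (2 * pi * x) = cis (2 * pi * y) \<longleftrightarrow> (\<exists>n::int. x = y + of_int n)"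
proof -
  have "cis (2 * pi * x) = cis (2 * pi * y) \<longleftrightarrow> (\<exists>n::int. 2 * pi * x = 2 * pi * y + 2 * pi * of_int n)"
    using sin_cos_eq_iff[of "2 * pi * x" "2 * pi * y"] by (auto simp: complex_eq_iff)
  also have "\<dots> \<longleftrightarrow> (\<exists>n::int. x = y + of_int n)"
    by (simp flip: distrib_left)
  finally show ?thesis .
qed

lemma cis_2pi_surj:
  assumes "norm z = 1" obtains u where "0 \<le> u" "u < 1" "cis (2 * pi * u) = z"
proof -
  obtain t where t: "z = cis t"
    using assms by (metis complex_norm_eq_1_exp_eq cis_conv_exp)
  have "cis (2 * pi * frac (t / (2 * pi))) = cis (2 * pi * (t / (2 * pi)))"
    unfolding cis_2pi_eq_iff by (intro exI[of _ "- \<lfloor>t / (2 * pi)\<rfloor>"]) (simp add: frac_def)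
  then show ?thesis
    using that[of "frac (t / (2 * pi))"] t by (simp add: frac_lt_1)
qed

lemma winding_eq_iff:
  "winding (x, y) = winding (x', y') \<longleftrightarrow>
     (\<exists>m n. x = x' + of_int m \<and> y = y' + of_int n \<and> 8 dvd m + 2 * n)"
proof -
  have "winding (x, y) = winding (x', y') \<longleftrightarrow>
    (\<exists>k n. (x + 2 * y) / 8 = (x' + 2 * y') / 8 + of_int k \<and> y = y' + of_int n)"
    unfolding winding_def prod.inject fst_conv snd_conv cis_2pi_eq_iff by blast
  also have "\<dots> \<longleftrightarrow> (\<exists>m n. x = x' + of_int m \<and> y = y' + of_int n \<and> 8 dvd m + 2 * n)"
  proof safe
    fix k n :: int assume "(x + 2 * (y' + of_int n)) / 8 = (x' + 2 * y') / 8 + of_int k"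
    then have "x = x' + of_int (8 * k - 2 * n)" by (simp add: field_simps)
    then show "\<exists>m n'. x = x' + of_int m \<and> y' + of_int n = y' + of_int n' \<and> 8 dvd m + 2 * n'"
      by (intro exI[of _ "8 * k - 2 * n"] exI[of _ n]) auto
  next
    fix m n :: int assume "8 dvd m + 2 * n"
    then obtain k where "m + 2 * n = 8 * k" by blast
    then have "m = 8 * k - 2 * n" by simp
    then show "\<exists>k n'. (x' + of_int m + 2 * (y' + of_int n)) / 8 = (x' + 2 * y') / 8 + of_int k \<and>
                 y' + of_int n = y' + of_int n'"
      by (intro exI[of _ k] exI[of _ n]) (simp add: field_simps)
  qed
  finally show ?thesis .
qed

text \<open>The lower left corner of a half-open square has positive weight. Hence each of \<open>i\<close> and \<open>j\<close> exceeds
  the other by one of 0, 1, 2, 3 modulo 8, which forces them to be congruent.\<close>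
lemma cell_inject:
  assumes eq: "cell i f g = cell j f' g'"
    and fg: "0 \<le> f" "f < 1" "0 \<le> g" "g < 1" "0 \<le> f'" "f' < 1" "0 \<le> g'" "g' < 1"
  shows "i mod 8 = j mod 8" "f = f'" "g = g'"
proof -
  have "cell j f' g' (residue i) \<noteq> 0" "cell i f g (residue j) \<noteq> 0"
    using eq[symmetric] cell_values(1)[of i f g] eq cell_values(1)[of j f' g'] fg by auto
  then have "residue i \<in> {residue j, residue (j + 1), residue (j + 2), residue (j + 3)}"
       "residue j \<in> {residue i, residue (i + 1), residue (i + 2), residue (i + 3)}"
    using cell_outside by metis+
  then show ij: "i mod 8 = j mod 8"
    unfolding insert_iff residue_eq_iff empty_iff mod_eq_dvd_iff by (elim disjE; presburger)
  have "cell i f g = cell i f' g'"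
    using eq cell_cong[OF ij] by simp
  then have "1 - max f g = 1 - max f' g'" "min f g = min f' g'" "max 0 (f - g) = max 0 (f' - g')"
    using cell_values(1)[of i] cell_values(2)[of i] cell_values(4)[of i] by metis+
  then show "f = f'" "g = g'"
    by (auto simp: max_def min_def split: if_splits)
qed

lemma unroll_eq_iff_winding_eq: "winding p = winding p' \<longleftrightarrow> unroll p = unroll p'"
proof -
  obtain x y x' y' where p: "p = (x, y)" "p' = (x', y')" by (metis surj_pair)
  have "(\<exists>m n. x = x' + of_int m \<and> y = y' + of_int n \<and> 8 dvd m + 2 * n) \<longleftrightarrow>
        unroll (x, y) = unroll (x', y')"
  proof
    assume "\<exists>m n. x = x' + of_int m \<and> y = y' + of_int n \<and> 8 dvd m + 2 * n"
    then obtain m n where mn: "x = x' + of_int m" "y = y' + of_int n" "8 dvd m + 2 * n" by blast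
    then have "\<lfloor>x\<rfloor> + 2 * \<lfloor>y\<rfloor> = (\<lfloor>x'\<rfloor> + 2 * \<lfloor>y'\<rfloor>) + (m + 2 * n)" by simp
    then have "(\<lfloor>x\<rfloor> + 2 * \<lfloor>y\<rfloor>) mod 8 = (\<lfloor>x'\<rfloor> + 2 * \<lfloor>y'\<rfloor>) mod 8"
      using mn(3) by (simp add: mod_eq_dvd_iff)
    then have "unroll (x, y) = cell (\<lfloor>x'\<rfloor> + 2 * \<lfloor>y'\<rfloor>) (frac x) (frac y)"
      unfolding unroll_def fst_conv snd_conv by (rule cell_cong)
    moreover have "frac x = frac x'" "frac y = frac y'" using mn by (simp_all add: frac_def)
    ultimately show "unroll (x, y) = unroll (x', y')"
      unfolding unroll_def by simp
  next
    assume "unroll (x, y) = unroll (x', y')"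
    note inject = cell_inject[OF this[unfolded unroll_def fst_conv snd_conv]
        frac_ge_0 frac_lt_1 frac_ge_0 frac_lt_1 frac_ge_0 frac_lt_1 frac_ge_0 frac_lt_1]
    then show "\<exists>m n. x = x' + of_int m \<and> y = y' + of_int n \<and> 8 dvd m + 2 * n"
      by (intro exI[of _ "\<lfloor>x\<rfloor> - \<lfloor>x'\<rfloor>"] exI[of _ "\<lfloor>y\<rfloor> - \<lfloor>y'\<rfloor>"])
         (use inject in \<open>auto simp: frac_def mod_eq_dvd_iff algebra_simps\<close>)
  qed
  then show ?thesis using winding_eq_iff p by simp
qed

lemma winding_image: "winding ` strip = torus"
proof
  show "winding ` strip \<subseteq> torus" by (auto simp: winding_def torus_def)
  show "torus \<subseteq> winding ` strip"
  proof
    fix w assume w: "w \<in> torus"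
    then obtain u v where u: "cis (2 * pi * u) = fst w"
        and v: "0 \<le> v" "v < 1" "cis (2 * pi * v) = snd w"
      unfolding torus_def by (metis cis_2pi_surj mem_Times_iff mem_sphere_0)
    (* The equation (x + 2 * v) / 8 = u, solved for x and reduced modulo 8 into the strip. *)
    define x where "x = 8 * frac (u - v / 4)"
    have "(x + 2 * v) / 8 = u + of_int (- \<lfloor>u - v / 4\<rfloor>)" by (simp add: x_def frac_def)
    then have "cis (2 * pi * ((x + 2 * v) / 8)) = cis (2 * pi * u)"
      unfolding cis_2pi_eq_iff by blast
    moreover have "x \<in> {0..8}" using frac_lt_1[of "u - v / 4"] by (simp add: x_def)
    ultimately show "w \<in> winding ` strip"
      using u v by (intro image_eqI[of _ _ "(x, v)"]) (auto simp: winding_def prod_eq_iff)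
  qed
qed

lemma cyclic_torus_period:
  assumes "\<sigma> \<in> cyclic_torus"
  obtains a :: int where "0 \<le> a" "a \<le> 7" "\<sigma> \<subseteq> {residue a, residue (a + 1), residue (a + 3)} \<or>
                                \<sigma> \<subseteq> {residue a, residue (a + 2), residue (a + 3)}"
proof -
  obtain i where i: "\<sigma> \<subseteq> {residue i, residue (i + 1), residue (i + 3)} \<or>
                                \<sigma> \<subseteq> {residue i, residue (i + 2), residue (i + 3)}"
    using assms by (auto simp: cyclic_torus_def)
  have "residue (i mod 8 + k) = residue (i + k)" for k
    unfolding residue_eq_iff by (simp add: mod_add_left_eq)
  from this[of 0] this[of 1] this[of 2] this[of 3] show ?thesis
    using i that[of "i mod 8"] by (simp add: pos_mod_bound[of 8 i, simplified zle_diff1_eq])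
qed

lemma underlying_space_sum:
  assumes "{v. t v \<noteq> 0} \<subseteq> A" "finite A"
  shows "(\<Sum>v | t v \<noteq> 0. t v) = (\<Sum>v\<in>A. t v :: real)"
  using assms by (intro sum.mono_neutral_left) auto

text \<open>The image of a square lies in the two triangles spanned by its corners because one of the
  coordinates at \<open>i + 1\<close> and \<open>i + 2\<close> vanishes; conversely \<open>f\<close> and \<open>g\<close> are recovered as the total
  weights on the right and on the upper edge.\<close>
lemma unroll_image: "unroll ` strip = underlying_space cyclic_torus"
proof
  show "unroll ` strip \<subseteq> underlying_space cyclic_torus"
  proof
    fix t assume "t \<in> unroll ` strip"
    then obtain i f g where t: "t = cell i f g" and fg: "0 \<le> f" "f < 1" "0 \<le> g" "g < 1"
      unfolding unroll_def using frac_lt_1 frac_ge_0 by blast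
    let ?A = "{residue i, residue (i + 1), residue (i + 2), residue (i + 3)}"
    have nonneg: "t v \<ge> 0" for v
      using fg by (auto simp: t cell_def)
    have supp: "{v. t v \<noteq> 0} \<subseteq> ?A"
      using cell_outside t by blast
    have sum: "(\<Sum>v | t v \<noteq> 0. t v) = 1"
      using underlying_space_sum[OF supp] residue_distinct[of i] by (simp add: t cell_values)
    have "t (residue (i + 1)) = 0 \<or> t (residue (i + 2)) = 0"
      by (auto simp: t cell_values)
    then have "{v. t v \<noteq> 0} \<subseteq> {residue i, residue (i + 1), residue (i + 3)} \<or>
               {v. t v \<noteq> 0} \<subseteq> {residue i, residue (i + 2), residue (i + 3)}"
      using supp by blast
    moreover have "{v. t v \<noteq> 0} \<noteq> {}"
      using sum by (metis sum.empty zero_neq_one)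
    ultimately show "t \<in> underlying_space cyclic_torus"
      using nonneg sum by (auto simp: underlying_space_def cyclic_torus_def)
  qed
  show "underlying_space cyclic_torus \<subseteq> unroll ` strip"
  proof
    fix t assume t: "t \<in> underlying_space cyclic_torus"
    define S where "S = {v. t v \<noteq> 0}"
    have nonneg: "t v \<ge> 0" for v using t by (simp add: underlying_space_def)
    obtain a where a: "0 \<le> a" "a \<le> 7"
      and S: "S \<subseteq> {residue a, residue (a + 1), residue (a + 3)} \<or>
              S \<subseteq> {residue a, residue (a + 2), residue (a + 3)}"
      using t cyclic_torus_period[of S] by (auto simp: underlying_space_def S_def)
    let ?t = "\<lambda>k. t (residue (a + k))"
    let ?A = "{residue (a + 0), residue (a + 1), residue (a + 2), residue (a + 3)}"
    have "S \<subseteq> ?A" using S by auto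
    then have out: "t v = 0" if "v \<notin> ?A" for v using that by (auto simp: S_def)
    have "(\<Sum>v\<in>?A. t v) = 1"
      using underlying_space_sum[of t ?A] t \<open>S \<subseteq> ?A\<close>
      unfolding underlying_space_def S_def by simp
    then have sum: "?t 0 + ?t 1 + ?t 2 + ?t 3 = 1"
      using residue_distinct[of a] by simp
    have zero: "?t 1 = 0 \<or> ?t 2 = 0"
      using S residue_distinct[of a] by (auto simp: S_def)
    define f g where "f = ?t 1 + ?t 3" and "g = ?t 2 + ?t 3"
    have fg: "0 \<le> f" "f \<le> 1" "0 \<le> g" "g \<le> 1"
      using nonneg[of "residue (a + 0)"] nonneg[of "residue (a + 1)"]
        nonneg[of "residue (a + 2)"] nonneg[of "residue (a + 3)"] sum
      unfolding f_def g_def by linarith+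
    have "t = cell a f g"
    proof
      fix v
      consider "v \<notin> ?A" | "v = residue (a + 0)" | "v = residue (a + 1)" | "v = residue (a + 2)"
        | "v = residue (a + 3)" by blast
      then show "t v = cell a f g v"
      proof cases
        case 1 then show ?thesis using out[OF 1] cell_outside[of v a] by simp
      qed (use zero sum nonneg[of "residue (a + 1)"] nonneg[of "residue (a + 2)"] in
           \<open>auto simp: cell_values f_def g_def max_def min_def\<close>)
    qed
    also have "\<dots> = unroll (of_int a + f, g)"
      using unroll_cell[OF fg, of a 0] by simp
    finally show "t \<in> unroll ` strip"
      using a fg by (intro image_eqI[of _ _ "(of_int a + f, g)"]) auto
  qed
qed

theorem cyclic_torus_homeomorphic: "underlying_space cyclic_torus homeomorphic torus"
proof (rule homeomorphic_common_quotient[of strip winding _ unroll])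
  show "compact strip" by (intro compact_Times) auto
  show "continuous_on strip winding"
    unfolding winding_def by (intro continuous_intros) auto
qed (use winding_image unroll_image continuous_on_unroll unroll_eq_iff_winding_eq in auto)

section \<open>Realizing the cross-polytope skeleton in space\<close>
definition affine_extension :: "('v \<Rightarrow> real^3) \<Rightarrow> ('v \<Rightarrow> real) \<Rightarrow> real^3" where
  "affine_extension \<phi> t = (\<Sum>v | t v \<noteq> 0. t v *\<^sub>R \<phi> v)"

lemma affine_extension_superset:
  assumes "{v. t v \<noteq> 0} \<subseteq> A" "finite A"
  shows "affine_extension \<phi> t = (\<Sum>v\<in>A. t v *\<^sub>R \<phi> v)"
  unfolding affine_extension_def using assms by (intro sum.mono_neutral_left) auto

lemma affine_extension_in_hull:
  assumes t: "t \<in> underlying_space K" and K: "abstract_simplicial_complex K" and "{v. t v \<noteq> 0} \<subseteq> \<rho>"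
  shows "affine_extension \<phi> t \<in> convex hull (\<phi> ` \<rho>)"
  unfolding affine_extension_def
proof (rule convex_sum[OF _ convex_convex_hull])
  show "finite {v. t v \<noteq> 0}" "sum t {v. t v \<noteq> 0} = 1"
    using t K by (auto simp: underlying_space_def abstract_simplicial_complex_def)
qed (use t assms(3) in \<open>auto simp: underlying_space_def intro!: hull_inc\<close>)

lemma hull_eq_affine_extension:
  assumes K: "abstract_simplicial_complex K" and \<sigma>: "\<sigma> \<in> K" and x: "x \<in> convex hull (\<phi> ` \<sigma>)"
  shows "\<exists>t. t \<in> underlying_space K \<and> {v. t v \<noteq> 0} \<subseteq> \<sigma> \<and> affine_extension \<phi> t = x"
proof -
  obtain \<rho> where \<rho>: "\<rho> \<subseteq> \<sigma>" "inj_on \<phi> \<rho>" "\<phi> ` \<sigma> = \<phi> ` \<rho>"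
    using subset_image_inj[of "\<phi> ` \<sigma>" \<phi> \<sigma>] by auto
  have fin: "finite \<sigma>" using K \<sigma> by (auto simp: abstract_simplicial_complex_def)
  then have "finite \<rho>" using \<rho> finite_subset by blast
  then obtain u where u: "\<forall>y\<in>\<phi> ` \<rho>. 0 \<le> u y" "sum u (\<phi> ` \<rho>) = 1" "(\<Sum>y\<in>\<phi> ` \<rho>. u y *\<^sub>R y) = x"
    using x unfolding \<rho>(3) by (subst (asm) convex_hull_finite) auto
  define t where "t v = (if v \<in> \<rho> then u (\<phi> v) else 0)" for v
  have supp: "{v. t v \<noteq> 0} \<subseteq> \<rho>" by (auto simp: t_def)
  have sum: "(\<Sum>v | t v \<noteq> 0. t v) = 1"
    using u(2) underlying_space_sum[OF supp \<open>finite \<rho>\<close>] \<rho>(2) by (simp add: t_def sum.reindex)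
  then have "{v. t v \<noteq> 0} \<noteq> {}" by (metis sum.empty zero_neq_one)
  then have "{v. t v \<noteq> 0} \<in> K"
    using K \<sigma> supp \<rho>(1) unfolding abstract_simplicial_complex_def by (meson subset_trans)
  then have "t \<in> underlying_space K"
    using sum u(1) by (auto simp: underlying_space_def t_def)
  moreover have "affine_extension \<phi> t = x"
    using u(3) \<rho>(2) unfolding affine_extension_superset[OF supp \<open>finite \<rho>\<close>]
    by (simp add: t_def sum.reindex)
  ultimately show ?thesis using supp \<rho>(1) by blast
qed

text \<open>If a point determines its barycentric coordinates, then a common point of two simplices has its
  coordinates supported on their common face. Affine dependence of the vertices of a simplex would, by
  Radon's theorem, give two disjoint faces with intersecting hulls, which this excludes as well.\<close>
lemma geometric_realizationI:
  assumes K: "abstract_simplicial_complex K" and inj: "inj_on (affine_extension \<phi>) (underlying_space K)"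
  shows "geometric_realization K \<phi>"
proof -
  have hulls: "convex hull (\<phi> ` \<sigma>) \<inter> convex hull (\<phi> ` \<tau>) = convex hull (\<phi> ` (\<sigma> \<inter> \<tau>))"
    if \<sigma>: "\<sigma> \<in> K" and \<tau>: "\<tau> \<in> K" for \<sigma> \<tau>
  proof
    show "convex hull (\<phi> ` (\<sigma> \<inter> \<tau>)) \<subseteq> convex hull (\<phi> ` \<sigma>) \<inter> convex hull (\<phi> ` \<tau>)"
      by (simp add: hull_mono image_mono)
    show "convex hull (\<phi> ` \<sigma>) \<inter> convex hull (\<phi> ` \<tau>) \<subseteq> convex hull (\<phi> ` (\<sigma> \<inter> \<tau>))"
    proof
      fix x assume x: "x \<in> convex hull (\<phi> ` \<sigma>) \<inter> convex hull (\<phi> ` \<tau>)"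
      obtain s where s: "s \<in> underlying_space K" "{v. s v \<noteq> 0} \<subseteq> \<sigma>" "affine_extension \<phi> s = x"
        using hull_eq_affine_extension[OF K \<sigma>, of x \<phi>] x by blast
      obtain t where t: "t \<in> underlying_space K" "{v. t v \<noteq> 0} \<subseteq> \<tau>" "affine_extension \<phi> t = x"
        using hull_eq_affine_extension[OF K \<tau>, of x \<phi>] x by blast
      have "s = t" using inj s t by (auto dest: inj_onD)
      then show "x \<in> convex hull (\<phi> ` (\<sigma> \<inter> \<tau>))"
        using affine_extension_in_hull[OF s(1) K, of "\<sigma> \<inter> \<tau>"] s t by blast
    qed
  qed
  have sub: "\<rho> \<in> K" if "\<sigma> \<in> K" "\<rho> \<subseteq> \<sigma>" "\<rho> \<noteq> {}" for \<rho> \<sigma>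
    using K that unfolding abstract_simplicial_complex_def by blast
  have disjoint: "convex hull (\<phi> ` \<rho>) \<inter> convex hull (\<phi> ` \<rho>') = {}"
    if "\<sigma> \<in> K" "\<rho> \<subseteq> \<sigma>" "\<rho>' \<subseteq> \<sigma>" "\<rho> \<inter> \<rho>' = {}" for \<rho> \<rho>' \<sigma>
    using hulls[OF sub sub] that by (cases "\<rho> = {}"; cases "\<rho>' = {}") auto
  have "inj_on \<phi> \<sigma>" if "\<sigma> \<in> K" for \<sigma>
  proof (rule inj_onI, rule ccontr)
    fix v w assume "v \<in> \<sigma>" "w \<in> \<sigma>" "\<phi> v = \<phi> w" "v \<noteq> w"
    then show False using disjoint[OF that, of "{v}" "{w}"] by simp
  qed
  moreover have "\<not> affine_dependent (\<phi> ` \<sigma>)" if "\<sigma> \<in> K" for \<sigma>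
  proof
    assume "affine_dependent (\<phi> ` \<sigma>)"
    then obtain M P where MP: "M \<subseteq> \<phi> ` \<sigma>" "P \<subseteq> \<phi> ` \<sigma>" "M \<inter> P = {}" "convex hull M \<inter> convex hull P \<noteq> {}"
      using Radon by metis
    then obtain \<rho> \<rho>' where "\<rho> \<subseteq> \<sigma>" "M = \<phi> ` \<rho>" "\<rho>' \<subseteq> \<sigma>" "P = \<phi> ` \<rho>'"
      using MP by (metis subset_imageE)
    moreover from this have "\<rho> \<inter> \<rho>' = {}" using MP(3) by blast
    ultimately show False using disjoint[OF that, of \<rho> \<rho>'] MP(4) by simp
  qed
  ultimately show ?thesis using hulls by (simp add: geometric_realization_def)
qed

lemma geometric_realization_relabel:
  assumes L: "geometric_realization L \<phi>" and inj: "inj \<pi>" and sub: "\<And>\<sigma>. \<sigma> \<in> K \<Longrightarrow> \<pi> ` \<sigma> \<in> L"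
  shows "geometric_realization K (\<phi> \<circ> \<pi>)"
  unfolding geometric_realization_def
proof (intro conjI ballI)
  fix \<sigma> assume \<sigma>: "\<sigma> \<in> K"
  show "inj_on (\<phi> \<circ> \<pi>) \<sigma>"
    using L sub[OF \<sigma>] inj by (simp add: geometric_realization_def comp_inj_on inj_on_subset)
  show "\<not> affine_dependent ((\<phi> \<circ> \<pi>) ` \<sigma>)"
    using L sub[OF \<sigma>] by (metis geometric_realization_def image_comp)
  fix \<tau> assume \<tau>: "\<tau> \<in> K"
  have "\<pi> ` (\<sigma> \<inter> \<tau>) = \<pi> ` \<sigma> \<inter> \<pi> ` \<tau>"
    using inj by (rule image_Int)
  then show "convex hull ((\<phi> \<circ> \<pi>) ` \<sigma>) \<inter> convex hull ((\<phi> \<circ> \<pi>) ` \<tau>) = convex hull ((\<phi> \<circ> \<pi>) ` (\<sigma> \<inter> \<tau>))"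
    using L sub[OF \<sigma>] sub[OF \<tau>] unfolding geometric_realization_def by (metis image_comp)
qed

text \<open>Two vertices of the cross-polytope span an edge unless they are opposite, and any set of vertices
  without an opposite pair is a face; \<open>k\<close> and \<open>k + 4\<close> label opposite vertices.\<close>
definition crosspolytope_skeleton :: "nat set set" where
  "crosspolytope_skeleton = {\<sigma>. \<sigma> \<noteq> {} \<and> \<sigma> \<subseteq> {..<8} \<and> card \<sigma> \<le> 3 \<and> (\<forall>k<4. \<not> (k \<in> \<sigma> \<and> k + 4 \<in> \<sigma>))}"

lemma crosspolytope_skeleton_complex: "abstract_simplicial_complex crosspolytope_skeleton"
proof -
  have "finite crosspolytope_skeleton"
    by (rule finite_subset[of _ "Pow {..<8}"]) (auto simp: crosspolytope_skeleton_def)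
  moreover have "finite \<sigma>" if "\<sigma> \<in> crosspolytope_skeleton" for \<sigma>
    using that finite_subset[of \<sigma> "{..<8}"] by (auto simp: crosspolytope_skeleton_def)
  moreover have "\<tau> \<in> crosspolytope_skeleton" if "\<sigma> \<in> crosspolytope_skeleton" "\<tau> \<subseteq> \<sigma>" "\<tau> \<noteq> {}" for \<sigma> \<tau>
    using that card_mono[OF calculation(2)[OF that(1)] that(2)]
    unfolding crosspolytope_skeleton_def by auto
  moreover have "\<sigma> \<noteq> {}" if "\<sigma> \<in> crosspolytope_skeleton" for \<sigma>
    using that by (simp add: crosspolytope_skeleton_def)
  ultimately show ?thesis
    unfolding abstract_simplicial_complex_def by blast
qed

text \<open>The three unit vectors and the negative of their sum. Up to scalars, the only linear relation
  between these four vectors is that their sum vanishes.\<close>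
definition tetrahedron_vertex :: "nat \<Rightarrow> real^3" where
  "tetrahedron_vertex k =
     vector [of_bool (k = 0) - of_bool (k = 3), of_bool (k = 1) - of_bool (k = 3), of_bool (k = 2) - of_bool (k = 3)]"

text \<open>The Schlegel diagram of the cross-polytope with respect to the facet \<open>{0, 1, 2, 3}\<close>, which becomes
  the outer tetrahedron; each vertex of the inner tetrahedron lies opposite to the outer vertex of the
  same index. The size ratio has to be less than \<open>1 / 3\<close>, as the centres of the outer faces are the
  outer vertices multiplied by \<open>- 1 / 3\<close>.\<close>
definition schlegel :: "nat \<Rightarrow> real^3" where
  "schlegel v = (if v < 4 then 4 *\<^sub>R tetrahedron_vertex v else - tetrahedron_vertex (v - 4))"

lemma sum_lessThan_8:
  fixes f :: "nat \<Rightarrow> 'a::comm_monoid_add"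
  shows "(\<Sum>v<8. f v) = f 0 + f 1 + f 2 + f 3 + f 4 + f 5 + f 6 + f 7"
proof -
  have "{..<8} = {0, 1, 2, 3, 4, 5, 6, 7::nat}" by auto
  then show ?thesis by (simp add: add.assoc)
qed

text \<open>The numbers \<open>4 * t k - t (k + 4)\<close> are the coefficients of a point with respect to the four vectors
  \<open>tetrahedron_vertex k\<close>. Where at most one of \<open>t k\<close> and \<open>t (k + 4)\<close> is nonzero, their sum is a
  convex piecewise linear function of this coefficient, with slope \<open>- 1\<close> below zero and \<open>1 / 4\<close> above
  zero; in general the sum is at least this value. Lowering all four coefficients by \<open>\<delta>\<close> therefore loses at most \<open>\<delta> / 4\<close> of mass in each of
  three indices, but gains \<open>\<delta>\<close> in an index whose coefficient is not positive.\<close>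
lemma mass_shift:
  fixes t t' :: "nat \<Rightarrow> real"
  assumes nonneg: "\<And>v. t v \<ge> 0" "\<And>v. t' v \<ge> 0"
    and opp: "\<And>k. k < 4 \<Longrightarrow> t k = 0 \<or> t (k + 4) = 0"
    and shift: "\<And>k. k < 4 \<Longrightarrow> 4 * t k - t (k + 4) = 4 * t' k - t' (k + 4) + \<delta>"
    and k: "k < 4" "t k = 0" and \<delta>: "\<delta> \<ge> 0"
    and mass: "(\<Sum>v<8. t v) = (\<Sum>v<8. t' v)"
  shows "\<delta> = 0"
proof -
  let ?m = "\<lambda>j. t j + t (j + 4)" and ?m' = "\<lambda>j. t' j + t' (j + 4)"
  have far: "?m' j \<ge> ?m j - \<delta> / 4" if "j < 4" for j
    using opp[OF that] shift[OF that] nonneg(1)[of j] nonneg(1)[of "j + 4"] nonneg(2)[of j] nonneg(2)[of "j + 4"] \<delta> by auto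
  have near: "?m' k \<ge> ?m k + \<delta>"
    using k shift[OF k(1)] nonneg(2)[of k] by simp
  have "(\<Sum>j<4. ?m j) = (\<Sum>j<4. ?m' j)"
    using mass by (simp add: eval_nat_numeral)
  moreover have "(\<Sum>j\<in>{..<4} - {k}. ?m' j) \<ge> (\<Sum>j\<in>{..<4} - {k}. ?m j - \<delta> / 4)"
    by (intro sum_mono far) auto
  moreover have "(\<Sum>j\<in>{..<4} - {k}. ?m j - \<delta> / 4) = (\<Sum>j\<in>{..<4} - {k}. ?m j) - 3 / 4 * \<delta>"
    using k by (simp add: sum_subtractf)
  ultimately have "\<delta> \<le> 3 / 4 * \<delta>"
    using near k by (simp add: sum.remove[of "{..<4}" k])
  then show ?thesis using \<delta> by simp
qed

lemma schlegel_coordinates: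
  assumes t: "t \<in> underlying_space crosspolytope_skeleton"
  shows "affine_extension schlegel t $ 1 = (4 * t 0 - t 4) - (4 * t 3 - t 7)"
    "affine_extension schlegel t $ 2 = (4 * t 1 - t 5) - (4 * t 3 - t 7)"
    "affine_extension schlegel t $ 3 = (4 * t 2 - t 6) - (4 * t 3 - t 7)"
    "(\<Sum>v<8. t v) = 1" "\<And>v. t v \<ge> 0" "\<And>v. v \<ge> 8 \<Longrightarrow> t v = 0"
    "\<And>k. k < 4 \<Longrightarrow> t k = 0 \<or> t (k + 4) = 0" "\<exists>k<4. t k = 0"
proof -
  have supp: "{v. t v \<noteq> 0} \<in> crosspolytope_skeleton" and nonneg: "\<And>v. t v \<ge> 0"
    and sum: "(\<Sum>v | t v \<noteq> 0. t v) = 1"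
    using t by (auto simp: underlying_space_def)
  from supp have sub: "{v. t v \<noteq> 0} \<subseteq> {..<8}" by (simp add: crosspolytope_skeleton_def)
  note ext = affine_extension_superset[OF sub finite_lessThan, of schlegel]
  show "affine_extension schlegel t $ 1 = (4 * t 0 - t 4) - (4 * t 3 - t 7)"
    "affine_extension schlegel t $ 2 = (4 * t 1 - t 5) - (4 * t 3 - t 7)"
    "affine_extension schlegel t $ 3 = (4 * t 2 - t 6) - (4 * t 3 - t 7)"
    unfolding ext sum_lessThan_8 by (simp_all add: schlegel_def tetrahedron_vertex_def)
  show "(\<Sum>v<8. t v) = 1" "\<And>v. t v \<ge> 0" "\<And>v. v \<ge> 8 \<Longrightarrow> t v = 0"
    using underlying_space_sum[OF sub] sum nonneg sub by auto
  show "\<And>k. k < 4 \<Longrightarrow> t k = 0 \<or> t (k + 4) = 0"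
    using supp by (auto simp: crosspolytope_skeleton_def)
  show "\<exists>k<4. t k = 0"
  proof (rule ccontr)
    assume "\<not> (\<exists>k<4. t k = 0)"
    then have "{..<4} \<subseteq> {v. t v \<noteq> 0}" by auto
    then have "card {..<4::nat} \<le> card {v. t v \<noteq> 0}"
      using sub by (intro card_mono finite_subset[OF sub]) auto
    then show False using supp by (simp add: crosspolytope_skeleton_def)
  qed
qed

text \<open>Two points with the same image have coefficients that differ by a common constant, because of the
  only linear relation between the vertices of a tetrahedron centred at the origin. Both have total
  mass 1, and both have a nonpositive coefficient since a triangle misses one of the outer vertices; so
  \<open>mass_shift\<close> applies in whichever direction the shift is nonnegative.\<close>
lemma inj_on_schlegel: "inj_on (affine_extension schlegel) (underlying_space crosspolytope_skeleton)"
proof (rule inj_onI)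
  fix s t assume s: "s \<in> underlying_space crosspolytope_skeleton"
    and t: "t \<in> underlying_space crosspolytope_skeleton"
    and eq: "affine_extension schlegel s = affine_extension schlegel t"
  note s = schlegel_coordinates[OF s] and t = schlegel_coordinates[OF t]
  define \<delta> where "\<delta> = (4 * s 3 - s 7) - (4 * t 3 - t 7)"
  have shift: "4 * s k - s (k + 4) = 4 * t k - t (k + 4) + \<delta>" if "k < 4" for k
  proof -
    have "k \<in> {0, 1, 2, 3}" using that by auto
    then show ?thesis using s(1-3) t(1-3) unfolding eq \<delta>_def by auto
  qed
  have "\<delta> = 0"
  proof (cases "\<delta> \<ge> 0")
    case True
    obtain k where "k < 4" "s k = 0" using s by blast
    then show ?thesis
      using mass_shift[of s t \<delta> k] s t shift True by simp
  next
    case False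
    obtain k where "k < 4" "t k = 0" using t by blast
    then show ?thesis
      using mass_shift[of t s "- \<delta>" k] s t shift False by simp
  qed
  have pair: "s k = t k \<and> s (k + 4) = t (k + 4)" if "k < 4" for k
    using shift[OF that] \<open>\<delta> = 0\<close> s(7)[OF that] t(7)[OF that] s(5)[of k] s(5)[of "k + 4"] t(5)[of k] t(5)[of "k + 4"]
    by auto
  show "s = t"
  proof
    fix v :: nat
    consider "v < (4::nat)" | "4 \<le> v" "v < 8" | "v \<ge> 8" by linarith
    then show "s v = t v"
      using pair[of v] pair[of "v - 4"] s(6)[of v] t(6)[of v] by cases auto
  qed
qed

theorem schlegel_realization: "geometric_realization crosspolytope_skeleton schlegel"
  using crosspolytope_skeleton_complex inj_on_schlegel by (rule geometric_realizationI)

section \<open>Subcomplexes of a realized complex\<close>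
definition geometric_complex :: "('v \<Rightarrow> real^3) \<Rightarrow> 'v set set \<Rightarrow> (real^3) set set" where
  "geometric_complex \<phi> K = (\<lambda>\<sigma>. convex hull (\<phi> ` \<sigma>)) ` K"

lemma aff_dim_realized_simplex:
  assumes "geometric_realization L \<phi>" "\<sigma> \<in> L" "\<rho> \<subseteq> \<sigma>"
  shows "aff_dim (convex hull (\<phi> ` \<rho>)) = int (card \<rho>) - 1"
proof -
  have "inj_on \<phi> \<sigma>" "\<not> affine_dependent (\<phi> ` \<sigma>)"
    using assms by (auto simp: geometric_realization_def)
  then have "inj_on \<phi> \<rho>" "\<not> affine_dependent (\<phi> ` \<rho>)"
    using assms(3) inj_on_subset affine_independent_subset image_mono by metis+
  then show ?thesis
    using aff_dim_affine_independent[of "\<phi> ` \<rho>"] by (simp add: aff_dim_convex_hull card_image)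
qed

lemma simplex_realized_iff:
  assumes "geometric_realization L \<phi>" "\<sigma> \<in> L"
  shows "int n simplex (convex hull (\<phi> ` \<sigma>)) \<longleftrightarrow> card \<sigma> = n + 1"
proof
  assume "int n simplex (convex hull (\<phi> ` \<sigma>))"
  then show "card \<sigma> = n + 1"
    using aff_dim_simplex aff_dim_realized_simplex[OF assms, of \<sigma>] by fastforce
next
  assume "card \<sigma> = n + 1"
  then show "int n simplex (convex hull (\<phi> ` \<sigma>))"
    using assms by (intro simplex_convex_hull) (auto simp: geometric_realization_def card_image)
qed

text \<open>Simplices with the same hull have a common face with that hull, and the dimension of the hull counts
  the vertices.\<close>
lemma inj_on_realized_simplex:
  assumes L: "geometric_realization L \<phi>" and fin: "\<And>\<sigma>. \<sigma> \<in> L \<Longrightarrow> finite \<sigma>"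
  shows "inj_on (\<lambda>\<sigma>. convex hull (\<phi> ` \<sigma>)) L"
proof (rule inj_onI)
  fix \<sigma> \<tau> assume \<sigma>: "\<sigma> \<in> L" and \<tau>: "\<tau> \<in> L" and eq: "convex hull (\<phi> ` \<sigma>) = convex hull (\<phi> ` \<tau>)"
  then have int: "convex hull (\<phi> ` \<sigma>) = convex hull (\<phi> ` (\<sigma> \<inter> \<tau>))"
    using L unfolding geometric_realization_def by (metis inf.idem)
  then have "card (\<sigma> \<inter> \<tau>) = card \<sigma>" "card (\<sigma> \<inter> \<tau>) = card \<tau>"
    using aff_dim_realized_simplex[OF L \<sigma>, of \<sigma>] aff_dim_realized_simplex[OF L \<sigma>, of "\<sigma> \<inter> \<tau>"]
      aff_dim_realized_simplex[OF L \<tau>, of \<tau>] eq by auto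
  then show "\<sigma> = \<tau>"
    using card_subset_eq[of \<sigma> "\<sigma> \<inter> \<tau>"] card_subset_eq[of \<tau> "\<sigma> \<inter> \<tau>"] fin[OF \<sigma>] fin[OF \<tau>] by auto
qed

lemma one_skeleton_geometric_complex:
  assumes "geometric_realization L \<phi>" "C \<subseteq> L"
    and "\<And>\<sigma>. \<sigma> \<in> C \<Longrightarrow> finite \<sigma> \<and> \<sigma> \<noteq> {}"
  shows "one_skeleton (geometric_complex \<phi> C) = geometric_complex \<phi> {\<sigma> \<in> C. card \<sigma> \<le> 2}"
proof -
  have "0 simplex (convex hull (\<phi> ` \<sigma>)) \<or> 1 simplex (convex hull (\<phi> ` \<sigma>)) \<longleftrightarrow> card \<sigma> \<le> 2" if "\<sigma> \<in> C" for \<sigma>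
  proof -
    have "\<sigma> \<in> L" "card \<sigma> \<noteq> 0" using that assms by auto
    then show ?thesis
      using simplex_realized_iff[OF assms(1), of \<sigma> 0] simplex_realized_iff[OF assms(1), of \<sigma> 1] by auto
  qed
  then show ?thesis unfolding one_skeleton_def geometric_complex_def by blast
qed

lemma faces_geometric_complex:
  assumes "geometric_realization L \<phi>" "C \<subseteq> L"
  shows "faces (geometric_complex \<phi> C) = geometric_complex \<phi> {\<sigma> \<in> C. card \<sigma> = 3}"
proof -
  have "2 simplex (convex hull (\<phi> ` \<sigma>)) \<longleftrightarrow> card \<sigma> = 3" if "\<sigma> \<in> C" for \<sigma>
    using simplex_realized_iff[OF assms(1), of \<sigma> 2] that assms(2) by auto
  then show ?thesis unfolding faces_def geometric_complex_def by blast
qed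

section \<open>Complementary tori in the cross-polytope\<close>
definition cyclic_triangles :: "(nat \<times> nat \<times> nat) set" where
  "cyclic_triangles = (\<lambda>i. (residue i, residue (i + 1), residue (i + 3))) ` {0..7} \<union>
                      (\<lambda>i. (residue i, residue (i + 2), residue (i + 3))) ` {0..7}"

lemma cyclic_triangles_eq:
  "cyclic_triangles =
     {(0,2,3), (1,3,4), (2,4,5), (3,5,6), (4,6,7), (5,7,0), (6,0,1), (7,1,2),
      (0,1,3), (1,2,4), (2,3,5), (3,4,6), (4,5,7), (5,6,0), (6,7,1), (7,0,2)}"
proof -
  have "{0..7} = {0,1,2,3,4,5,6,7::int}" by auto
  then show ?thesis
    unfolding cyclic_triangles_def by (simp add: residue_def)
qed

lemma cyclic_torus_iff:
  "\<sigma> \<in> cyclic_torus \<longleftrightarrow> \<sigma> \<noteq> {} \<and> (\<exists>(a, b, c)\<in>cyclic_triangles. \<sigma> \<subseteq> {a, b, c})"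
proof
  assume \<sigma>: "\<sigma> \<in> cyclic_torus"
  then obtain a :: int where "0 \<le> a" "a \<le> 7" "\<sigma> \<subseteq> {residue a, residue (a + 1), residue (a + 3)} \<or>
                                \<sigma> \<subseteq> {residue a, residue (a + 2), residue (a + 3)}"
    by (rule cyclic_torus_period)
  moreover have "\<sigma> \<noteq> {}" using \<sigma> by (simp add: cyclic_torus_def)
  ultimately show "\<sigma> \<noteq> {} \<and> (\<exists>(a, b, c)\<in>cyclic_triangles. \<sigma> \<subseteq> {a, b, c})"
    unfolding cyclic_triangles_def bex_Un bex_simps split_conv by (meson atLeastAtMost_iff)
qed (auto simp: cyclic_torus_def cyclic_triangles_def)

lemmas cyclic_torus_simps = cyclic_torus_iff cyclic_triangles_eq

lemma cyclic_torus_subset: "cyclic_torus \<subseteq> crosspolytope_skeleton"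
proof
  fix \<sigma> assume \<sigma>: "\<sigma> \<in> cyclic_torus"
  have facet: "\<sigma> \<in> crosspolytope_skeleton"
    if "\<sigma> \<subseteq> {a, b, c}" "{a, b, c} \<subseteq> {..<8}" "a \<noteq> b + 4" "b \<noteq> a + 4" "a \<noteq> c + 4" "c \<noteq> a + 4" "b \<noteq> c + 4" "c \<noteq> b + 4" for a b c
  proof -
    have "card \<sigma> \<le> card {a, b, c}" using that(1) by (intro card_mono) auto
    also have "\<dots> \<le> 3" by (simp add: card_insert_if)
    finally have "card \<sigma> \<le> 3" .
    moreover have "\<not> (k \<in> \<sigma> \<and> k + 4 \<in> \<sigma>)" for k
    proof
      assume "k \<in> \<sigma> \<and> k + 4 \<in> \<sigma>"
      then have "k \<in> {a, b, c}" "k + 4 \<in> {a, b, c}" using that(1) by blast+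
      then show False using that(3-) by auto
    qed
    ultimately show ?thesis using that(1,2) \<sigma> by (auto simp: crosspolytope_skeleton_def cyclic_torus_def)
  qed
  obtain a b c where abc: "(a, b, c) \<in> cyclic_triangles" "\<sigma> \<subseteq> {a, b, c}"
    using \<sigma> by (auto simp: cyclic_torus_iff)
  show "\<sigma> \<in> crosspolytope_skeleton"
    by (rule facet[OF abc(2)]) (use abc(1) in \<open>auto simp: cyclic_triangles_eq\<close>)
qed

lemma short_edge_in_cyclic_torus:
  assumes "d \<in> {0, 1, 2, 3}" shows "{residue i, residue (i + d)} \<in> cyclic_torus"
proof -
  have "{residue i, residue (i + d)} \<subseteq> {residue i, residue (i + 1), residue (i + 3)} \<or>
        {residue i, residue (i + d)} \<subseteq> {residue i, residue (i + 2), residue (i + 3)}"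
    using assms by auto
  then show ?thesis unfolding cyclic_torus_def by blast
qed

text \<open>Labels that are not opposite differ by at most 3 in one of the two cyclic directions, and each of the
  differences 1, 2, 3 occurs as an edge of the squares. So the torus contains every edge of the
  cross-polytope.\<close>
lemma edges_in_cyclic_torus:
  assumes "\<sigma> \<in> crosspolytope_skeleton" "card \<sigma> \<le> 2"
  shows "\<sigma> \<in> cyclic_torus"
proof -
  have edge: "{u, v} \<in> cyclic_torus" if "u \<le> v" "v < 8" "v \<noteq> u + 4" for u v
  proof (cases "v < u + 4")
    case True
    then have "{residue (int u), residue (int u + (int v - int u))} \<in> cyclic_torus"
      using that by (intro short_edge_in_cyclic_torus) auto
    then show ?thesis using that by (simp add: residue_of_nat)
  next
    case False
    (* Here v - u is 5, 6 or 7, so u is reached from v by going on around the cycle. *)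
    have "residue (int v + (int u + 8 - int v)) = residue (int u)"
      unfolding residue_eq_iff by simp
    moreover have "{residue (int v), residue (int v + (int u + 8 - int v))} \<in> cyclic_torus"
      using that False by (intro short_edge_in_cyclic_torus) auto
    ultimately show ?thesis using that by (simp add: residue_of_nat insert_commute)
  qed
  have fin: "finite \<sigma>" "\<sigma> \<noteq> {}" "\<sigma> \<subseteq> {..<8}"
    using assms(1) finite_subset[of \<sigma> "{..<8}"] by (auto simp: crosspolytope_skeleton_def)
  then have "card \<sigma> \<noteq> 0" by simp
  then have "card \<sigma> = 1 \<or> card \<sigma> = 2" using assms(2) by linarith
  then obtain u v where \<sigma>: "\<sigma> = {u, v}"
    by (metis card_1_singletonE card_2_iff insert_absorb2)
  have "u < 8" "v < 8" using fin(3) by (auto simp: \<sigma>)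
  moreover have "v \<noteq> u + 4" "u \<noteq> v + 4"
    using assms(1) calculation by (auto simp: crosspolytope_skeleton_def \<sigma>)
  ultimately show ?thesis
    using edge[of u v] edge[of v u] by (cases "u \<le> v") (auto simp: \<sigma> insert_commute)
qed

definition skeleton_symmetry :: "(nat \<Rightarrow> nat) \<Rightarrow> bool" where
  "skeleton_symmetry \<pi> \<longleftrightarrow> inj \<pi> \<and> (\<forall>\<sigma>\<in>crosspolytope_skeleton. \<pi> ` \<sigma> \<in> crosspolytope_skeleton)"

lemma skeleton_symmetry_comp:
  "skeleton_symmetry \<pi> \<Longrightarrow> skeleton_symmetry \<rho> \<Longrightarrow> skeleton_symmetry (\<pi> \<circ> \<rho>)"
  unfolding skeleton_symmetry_def by (simp add: inj_compose image_comp[symmetric] del: o_apply)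

lemma skeleton_symmetry_inj: "skeleton_symmetry \<pi> \<Longrightarrow> inj \<pi>"
  by (simp add: skeleton_symmetry_def)

lemma card_image_inj: "inj \<pi> \<Longrightarrow> card (\<pi> ` \<sigma>) = card \<sigma>"
  by (rule card_image) (rule inj_on_subset[OF _ subset_UNIV])

lemma skeleton_symmetry_edges:
  assumes "skeleton_symmetry \<pi>"
  shows "(`) \<pi> ` {\<sigma> \<in> crosspolytope_skeleton. card \<sigma> \<le> 2} = {\<sigma> \<in> crosspolytope_skeleton. card \<sigma> \<le> 2}"
proof (rule endo_inj_surj)
  have inj: "inj \<pi>" using assms by (simp add: skeleton_symmetry_def)
  show "finite {\<sigma> \<in> crosspolytope_skeleton. card \<sigma> \<le> 2}"
    using crosspolytope_skeleton_complex by (simp add: abstract_simplicial_complex_def)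
  show "(`) \<pi> ` {\<sigma> \<in> crosspolytope_skeleton. card \<sigma> \<le> 2} \<subseteq> {\<sigma> \<in> crosspolytope_skeleton. card \<sigma> \<le> 2}"
    using assms by (auto simp: skeleton_symmetry_def card_image_inj)
  show "inj_on ((`) \<pi>) {\<sigma> \<in> crosspolytope_skeleton. card \<sigma> \<le> 2}"
    using inj by (simp add: inj_on_def inj_image_eq_iff)
qed

text \<open>It is enough to check the images of opposite vertices \<open>v\<close> and \<open>v + 4\<close> with \<open>v < 4\<close> in this order
  because the symmetries considered below preserve the outer and the inner tetrahedron.\<close>
lemma skeleton_symmetryI:
  assumes "inj \<pi>" "\<And>v. v < 8 \<Longrightarrow> \<pi> v < 8" "\<And>v. v < 4 \<Longrightarrow> \<pi> (v + 4) = \<pi> v + 4"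
  shows "skeleton_symmetry \<pi>"
  unfolding skeleton_symmetry_def
proof (intro conjI ballI)
  fix \<sigma> assume \<sigma>: "\<sigma> \<in> crosspolytope_skeleton"
  have "\<not> (k \<in> \<pi> ` \<sigma> \<and> k + 4 \<in> \<pi> ` \<sigma>)" if "k < 4" for k
  proof
    assume "k \<in> \<pi> ` \<sigma> \<and> k + 4 \<in> \<pi> ` \<sigma>"
    then obtain u v where uv: "u \<in> \<sigma>" "v \<in> \<sigma>" "k = \<pi> u" "k + 4 = \<pi> v" by auto
    have "u < 8" using uv \<sigma> by (auto simp: crosspolytope_skeleton_def)
    have "u < 4"
    proof (rule ccontr)
      assume "\<not> u < 4"
      then have "k = \<pi> (u - 4) + 4" using assms(3)[of "u - 4"] \<open>u < 8\<close> uv(3) by simp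
      then show False using that by simp
    qed
    then have "\<pi> v = \<pi> (u + 4)" using assms(3) uv by simp
    then have "v = u + 4" using assms(1) by (simp add: inj_eq)
    then show False using \<sigma> uv \<open>u < 4\<close> by (auto simp: crosspolytope_skeleton_def)
  qed
  moreover have "card (\<pi> ` \<sigma>) \<le> 3"
    using \<sigma> assms(1) by (simp add: crosspolytope_skeleton_def card_image_inj)
  ultimately show "\<pi> ` \<sigma> \<in> crosspolytope_skeleton"
    using \<sigma> assms(2) by (auto simp: crosspolytope_skeleton_def)
qed (fact assms(1))

abbreviation torus_image :: "(nat \<Rightarrow> nat) \<Rightarrow> nat set set" where
  "torus_image \<pi> \<equiv> (`) \<pi> ` cyclic_torus"

lemma cyclic_torus_triangulation: "torus_triangulation cyclic_torus"
proof -
  have "abstract_simplicial_complex cyclic_torus"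
    unfolding abstract_simplicial_complex_def
  proof (intro conjI ballI allI impI)
    show "finite cyclic_torus"
      using crosspolytope_skeleton_complex finite_subset[OF cyclic_torus_subset]
      by (simp add: abstract_simplicial_complex_def)
    show "finite \<sigma>" "\<sigma> \<noteq> {}" if "\<sigma> \<in> cyclic_torus" for \<sigma>
      using that finite_subset by (auto simp: cyclic_torus_def)
    show "\<tau> \<in> cyclic_torus" if "\<sigma> \<in> cyclic_torus" "\<tau> \<subseteq> \<sigma> \<and> \<tau> \<noteq> {}" for \<sigma> \<tau>
      using that unfolding cyclic_torus_def by blast
  qed
  moreover have "two_dimensional cyclic_torus"
    unfolding two_dimensional_def
  proof
    show "\<forall>\<sigma>\<in>cyclic_torus. card \<sigma> \<le> 3"
      using cyclic_torus_subset by (auto simp: crosspolytope_skeleton_def)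
    show "\<exists>\<sigma>\<in>cyclic_torus. card \<sigma> = 3"
      by (rule bexI[of _ "{0, 1, 3}"]) (simp_all add: cyclic_torus_simps)
  qed
  ultimately show ?thesis
    using cyclic_torus_homeomorphic by (simp add: torus_triangulation_def)
qed

lemma torus_image_subset: "skeleton_symmetry \<pi> \<Longrightarrow> torus_image \<pi> \<subseteq> crosspolytope_skeleton"
  using cyclic_torus_subset by (auto simp: skeleton_symmetry_def)

text \<open>Every image of the torus is realized by the same abstract complex, with the vertices placed according
  to the symmetry.\<close>
lemma toroidal_torus_image:
  assumes "skeleton_symmetry \<pi>"
  shows "geometric_toroidal_polyhedron (geometric_complex schlegel (torus_image \<pi>))"
  unfolding geometric_toroidal_polyhedron_def
proof (intro exI conjI)
  show "torus_triangulation cyclic_torus" by (fact cyclic_torus_triangulation)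
  show "geometric_realization cyclic_torus (schlegel \<circ> \<pi>)"
    using schlegel_realization assms cyclic_torus_subset
    by (intro geometric_realization_relabel) (auto simp: skeleton_symmetry_def)
  show "geometric_complex schlegel (torus_image \<pi>) = (\<lambda>\<sigma>. convex hull (schlegel \<circ> \<pi>) ` \<sigma>) ` cyclic_torus"
    by (simp add: geometric_complex_def image_comp o_def)
qed

lemma one_skeleton_torus_image:
  assumes \<pi>: "skeleton_symmetry \<pi>"
  shows "one_skeleton (geometric_complex schlegel (torus_image \<pi>)) =
         geometric_complex schlegel {\<sigma> \<in> crosspolytope_skeleton. card \<sigma> \<le> 2}"
proof -
  have card: "card (\<pi> ` \<sigma>) = card \<sigma>" for \<sigma>
    using \<pi> by (simp add: skeleton_symmetry_inj card_image_inj)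
  have "{\<sigma> \<in> torus_image \<pi>. card \<sigma> \<le> 2} = (`) \<pi> ` {\<sigma> \<in> cyclic_torus. card \<sigma> \<le> 2}"
    using card by auto
  also have "{\<sigma> \<in> cyclic_torus. card \<sigma> \<le> 2} = {\<sigma> \<in> crosspolytope_skeleton. card \<sigma> \<le> 2}"
    using cyclic_torus_subset edges_in_cyclic_torus by auto
  also have "(`) \<pi> ` \<dots> = \<dots>" using \<pi> by (rule skeleton_symmetry_edges)
  finally have edges: "{\<sigma> \<in> torus_image \<pi>. card \<sigma> \<le> 2} = {\<sigma> \<in> crosspolytope_skeleton. card \<sigma> \<le> 2}" .
  show ?thesis
    using one_skeleton_geometric_complex[OF schlegel_realization torus_image_subset[OF \<pi>]]
      torus_image_subset[OF \<pi>] crosspolytope_skeleton_complex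
    unfolding edges by (auto simp: abstract_simplicial_complex_def)
qed

text \<open>The exchange of the indices 0 and 2 and of the indices 1 and 3 in both tetrahedra, extended to an
  involution of all natural numbers.\<close>
definition flip :: "nat \<Rightarrow> nat" where
  "flip v = (if v mod 4 < 2 then v + 2 else v - 2)"

lemma flip_flip [simp]: "flip (flip v) = v"
proof (cases "v mod 4 < 2")
  case True
  then have "\<not> (v + 2) mod 4 < 2" by presburger
  then show ?thesis using True by (simp add: flip_def)
next
  case False
  then have "v \<ge> 2" using mod_less_eq_dividend[of v 4] by linarith
  then obtain w where v: "v = w + 2" by (metis le_add_diff_inverse2)
  then have "w mod 4 < 2" using False by presburger
  then show ?thesis using False v by (simp add: flip_def)
qed

lemma flip_values [simp]:
  "flip 0 = 2" "flip (Suc 0) = 3" "flip 2 = 0" "flip 3 = 1" "flip 4 = 6" "flip 5 = 7" "flip 6 = 4" "flip 7 = 5"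
  by (simp_all add: flip_def)

lemma skeleton_symmetry_flip: "skeleton_symmetry flip"
proof (rule skeleton_symmetryI)
  show "inj flip" by (rule inj_on_inverseI[of _ flip]) simp
  show "flip v < 8" if "v < 8" for v
  proof -
    have "v \<in> {0, 1, 2, 3, 4, 5, 6, 7}" using that by auto
    then show ?thesis by auto
  qed
  show "flip (v + 4) = flip v + 4" if "v < 4" for v
  proof -
    have "v \<in> {0, 1, 2, 3}" using that by auto
    then show ?thesis by auto
  qed
qed

lemma in_torus_image_flip: "\<sigma> \<in> torus_image flip \<longleftrightarrow> flip ` \<sigma> \<in> cyclic_torus"
proof
  assume "flip ` \<sigma> \<in> cyclic_torus"
  then show "\<sigma> \<in> torus_image flip"
    by (intro image_eqI[of _ _ "flip ` \<sigma>"]) (simp_all add: image_comp o_def)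
qed (auto simp: image_comp o_def)

text \<open>Every triangle of the cyclic torus contains \<open>0\<close> or \<open>4\<close> together with \<open>2\<close> or \<open>6\<close>, or \<open>1\<close> or \<open>5\<close>
  together with \<open>3\<close> or \<open>7\<close>. The remaining index of the triangle determines whether these two vertices
  belong to the same tetrahedron, and \<open>flip\<close> reverses this rule. Thus \<open>torus_image flip\<close> consists of
  the other half of the 32 triangles.\<close>
lemma flip_no_common_triangle:
  assumes "\<sigma> \<in> cyclic_torus" "card \<sigma> = 3"
  shows "\<sigma> \<notin> torus_image flip"
proof -
  have facet: "\<sigma> = {a, b, c}" if "\<sigma> \<subseteq> {a, b, c}" for a b c
    by (intro card_seteq[OF _ that]) (simp_all add: assms(2) card_insert_if)
  obtain a b c where abc: "(a, b, c) \<in> cyclic_triangles" "\<sigma> \<subseteq> {a, b, c}"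
    using assms(1) by (auto simp: cyclic_torus_iff)
  have "\<forall>(a, b, c)\<in>cyclic_triangles. {flip a, flip b, flip c} \<notin> cyclic_torus"
    by (simp add: cyclic_torus_simps)
  then have "flip ` {a, b, c} \<notin> cyclic_torus" using abc(1) by auto
  then show ?thesis unfolding in_torus_image_flip facet[OF abc(2)] .
qed

section \<open>Six pairs of tori\<close>

text \<open>The permutation \<open>p\<close> acts on the index \<open>v mod 4\<close> of the pair of opposite vertices to which \<open>v\<close>
  belongs, while \<open>v div 4\<close> distinguishes the outer from the inner tetrahedron.\<close>
definition relabel :: "(nat \<Rightarrow> nat) \<Rightarrow> nat \<Rightarrow> nat" where
  "relabel p v = 4 * (v div 4) + p (v mod 4)"

lemma permutes_less: "p permutes {..<3::nat} \<Longrightarrow> p k < 4 \<longleftrightarrow> k < 4"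
  using permutes_in_image[of p "{..<4}" k] permutes_subset[of p "{..<3}" "{..<4}"] by auto

lemma relabel_comp:
  assumes "p permutes {..<3}" "q permutes {..<3}"
  shows "relabel p \<circ> relabel q = relabel (p \<circ> q)"
  using permutes_less[OF assms(2)] by (simp add: relabel_def fun_eq_iff)

lemma skeleton_symmetry_relabel:
  assumes p: "p permutes {..<3}"
  shows "skeleton_symmetry (relabel p)"
proof (rule skeleton_symmetryI)
  have "relabel (inv p) \<circ> relabel p = relabel id"
    using relabel_comp[OF permutes_inv[OF p] p] permutes_inv_o(2)[OF p] by simp
  also have "\<dots> = id" by (simp add: relabel_def fun_eq_iff)
  finally have "relabel (inv p) (relabel p v) = v" for v by (simp add: fun_eq_iff)
  then show "inj (relabel p)" by (rule inj_on_inverseI)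
  show "relabel p v < 8" if "v < 8" for v
  proof -
    have "v div 4 < 2" using that by linarith
    moreover have "p (v mod 4) < 4" using permutes_less[OF p] by simp
    ultimately show ?thesis unfolding relabel_def by linarith
  qed
qed (simp add: relabel_def)

lemma torus_image_comp: "torus_image (\<pi> \<circ> \<rho>) = (`) \<pi> ` torus_image \<rho>"
  by (simp add: image_comp o_def)

lemma faces_disjoint:
  assumes \<pi>: "skeleton_symmetry \<pi>"
  shows "faces (geometric_complex schlegel (torus_image \<pi>)) \<inter>
         faces (geometric_complex schlegel (torus_image (\<pi> \<circ> flip))) = {}"
proof -
  have inj: "inj_on (\<lambda>\<sigma>. convex hull (schlegel ` \<sigma>)) crosspolytope_skeleton"
    using inj_on_realized_simplex[OF schlegel_realization] crosspolytope_skeleton_complex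
    by (auto simp: abstract_simplicial_complex_def)
  have sub: "torus_image \<pi> \<subseteq> crosspolytope_skeleton" "torus_image (\<pi> \<circ> flip) \<subseteq> crosspolytope_skeleton"
    using \<pi> skeleton_symmetry_flip skeleton_symmetry_comp torus_image_subset by metis+
  have "inj \<pi>" using \<pi> by (simp add: skeleton_symmetry_def)
  have "{\<sigma> \<in> torus_image \<pi>. card \<sigma> = 3} \<inter> {\<sigma> \<in> torus_image (\<pi> \<circ> flip). card \<sigma> = 3} = {}"
  proof (rule ccontr)
    assume "\<not> ?thesis"
    then obtain \<rho> \<tau> where \<rho>\<tau>: "\<rho> \<in> cyclic_torus" "card (\<pi> ` \<rho>) = 3" "\<pi> ` \<rho> = \<pi> ` \<tau>" "\<tau> \<in> torus_image flip"
      unfolding torus_image_comp by blast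
    then have "\<rho> = \<tau>" "card \<rho> = 3"
      using \<open>inj \<pi>\<close> by (simp_all add: inj_image_eq_iff card_image_inj)
    then show False using \<rho>\<tau> flip_no_common_triangle by blast
  qed
  then show ?thesis
    unfolding faces_geometric_complex[OF schlegel_realization sub(1)]
      faces_geometric_complex[OF schlegel_realization sub(2)]
    unfolding geometric_complex_def
    using sub by (subst inj_on_image_Int[OF inj, symmetric]) auto
qed

text \<open>The triangles \<open>{1, 2, 3}\<close> and \<open>{0, 2, 5}\<close> of this torus determine \<open>r\<close>: the other outer triangles
  through \<open>3\<close> do not belong to the torus, so \<open>r\<close> fixes 0, and \<open>{0, 1, 6}\<close> does not belong to it either,
  so \<open>r\<close> does not exchange 1 and 2.\<close>
lemma torus_image_flip_rigid:
  assumes r: "r permutes {..<3}" and eq: "(`) (relabel r) ` torus_image flip = torus_image flip"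
  shows "r = id"
proof -
  have inv: "relabel r ` \<sigma> \<in> torus_image flip" if "\<sigma> \<in> torus_image flip" for \<sigma>
    using that eq by blast
  have r3: "r 3 = 3" using r by (simp add: permutes_def)
  have range: "r 0 \<in> {0, 1, 2}" "r 1 \<in> {0, 1, 2}" "r 2 \<in> {0, 1, 2}"
    using permutes_in_image[OF r, of 0] permutes_in_image[OF r, of 1] permutes_in_image[OF r, of 2] by auto
  have inj: "r 0 \<noteq> r 1" "r 0 \<noteq> r 2" "r 1 \<noteq> r 2"
    using permutes_inj[OF r] by (simp_all add: inj_eq)
  have "{1, 2, 3} \<in> torus_image flip" "{0, 2, 5} \<in> torus_image flip"
    unfolding in_torus_image_flip by (simp_all add: cyclic_torus_simps)
  from this[THEN inv] have "{r 1, r 2, 3} \<in> torus_image flip" "{r 0, r 2, 4 + r 1} \<in> torus_image flip"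
    by (simp_all add: relabel_def r3)
  moreover have "{0, 2, 3} \<notin> torus_image flip" "{2, 0, 3} \<notin> torus_image flip"
    "{0, 1, 3} \<notin> torus_image flip" "{1, 0, 3} \<notin> torus_image flip" "{0, 1, 6} \<notin> torus_image flip"
    unfolding in_torus_image_flip by (simp_all add: cyclic_torus_simps)
  moreover have "(r 0, r 1, r 2) \<in> {(0, 1, 2), (0, 2, 1), (1, 0, 2), (1, 2, 0), (2, 0, 1), (2, 1, 0)}"
    using range inj by (elim insertE emptyE) simp_all
  ultimately have small: "r 0 = 0 \<and> r 1 = 1 \<and> r 2 = 2"
    unfolding insert_iff prod.inject empty_iff by (elim disjE conjE) simp_all
  have "r k = k" for k
  proof -
    consider "k = 0" | "k = 1" | "k = 2" | "k \<ge> 3" by linarith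
    then show ?thesis using small r by cases (auto simp: permutes_def)
  qed
  then show ?thesis by auto
qed

text \<open>Permutations of all four indices produce no further pairs: those that leave the pair of \<open>id\<close>
  invariant form the Klein four-group, of which the permutations fixing the index 3 are a complement in
  the symmetric group.\<close>
definition torus_pair :: "(nat \<Rightarrow> nat) \<Rightarrow> (real^3) set set set" where
  "torus_pair p = {geometric_complex schlegel (torus_image (relabel p)),
                   geometric_complex schlegel (torus_image (relabel p \<circ> flip))}"

text \<open>This triangle tells the two tori of a pair apart, because relabelling leaves it in place.\<close>
lemma outer_triangle:
  assumes p: "p permutes {..<3}"
  shows "{0, 1, 2} \<notin> torus_image (relabel p)" "{0, 1, 2} \<in> torus_image (relabel p \<circ> flip)"
proof -
  have image: "relabel p ` {0, 1, 2} = {0, 1, 2}"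
  proof -
    have "{0, 1, 2} = {..<3::nat}" by auto
    moreover have "relabel p ` {..<3} = p ` {..<3}" by (rule image_cong) (auto simp: relabel_def)
    ultimately show ?thesis using permutes_image[OF p] by simp
  qed
  show "{0, 1, 2} \<notin> torus_image (relabel p)"
  proof
    assume "{0, 1, 2} \<in> torus_image (relabel p)"
    then obtain \<sigma> where "\<sigma> \<in> cyclic_torus" "relabel p ` {0, 1, 2} = relabel p ` \<sigma>"
      using image by auto
    then have "{0, 1, 2} \<in> cyclic_torus"
      using inj_image_eq_iff[OF skeleton_symmetry_inj[OF skeleton_symmetry_relabel[OF p]]] by metis
    then show False by (simp add: cyclic_torus_simps)
  qed
  have "{0, 1, 2} \<in> torus_image flip"
    unfolding in_torus_image_flip by (simp add: cyclic_torus_simps)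
  then show "{0, 1, 2} \<in> torus_image (relabel p \<circ> flip)"
    unfolding torus_image_comp using image by (metis image_eqI)
qed

text \<open>If the pairs of \<open>p\<close> and \<open>q\<close> coincide, then so do their members containing the triangle
  \<open>{0, 1, 2}\<close>; hence \<open>inv q \<circ> p\<close> preserves \<open>torus_image flip\<close> and is the identity.\<close>
lemma inj_on_torus_pair: "inj_on torus_pair {p. p permutes {..<3}}"
proof (rule inj_onI)
  fix p q assume "p \<in> {p. p permutes {..<3}}" "q \<in> {p. p permutes {..<3}}" and eq: "torus_pair p = torus_pair q"
  then have p: "p permutes {..<3}" and q: "q permutes {..<3}" by auto
  have sub: "torus_image (relabel p') \<subseteq> crosspolytope_skeleton"
      "torus_image (relabel p' \<circ> flip) \<subseteq> crosspolytope_skeleton" if "p' permutes {..<3}" for p'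
    using that skeleton_symmetry_flip skeleton_symmetry_comp torus_image_subset skeleton_symmetry_relabel by metis+
  have inj: "geometric_complex schlegel C = geometric_complex schlegel C' \<longleftrightarrow> C = C'"
    if "C \<subseteq> crosspolytope_skeleton" "C' \<subseteq> crosspolytope_skeleton" for C C'
    unfolding geometric_complex_def using that inj_on_realized_simplex[OF schlegel_realization] crosspolytope_skeleton_complex
    by (intro inj_on_image_eq_iff) (auto simp: abstract_simplicial_complex_def)
  have "geometric_complex schlegel (torus_image (relabel p \<circ> flip)) \<noteq> geometric_complex schlegel (torus_image (relabel q))"
    using inj sub[OF p] sub[OF q] outer_triangle[OF p] outer_triangle[OF q] by metis
  then have "torus_image (relabel p \<circ> flip) = torus_image (relabel q \<circ> flip)"
    using eq inj sub[OF p] sub[OF q] unfolding torus_pair_def by (metis doubleton_eq_iff)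
  moreover define r where "r = inv q \<circ> p"
  have r: "r permutes {..<3}" unfolding r_def using p permutes_inv[OF q] by (rule permutes_compose)
  have p_eq: "p = q \<circ> r" unfolding r_def using permutes_inv_o(1)[OF q] by (simp add: o_assoc)
  have "relabel p \<circ> flip = relabel q \<circ> (relabel r \<circ> flip)"
    using relabel_comp[OF q r] p_eq by (simp add: o_assoc)
  ultimately have "(`) (relabel q) ` torus_image (relabel r \<circ> flip) = (`) (relabel q) ` torus_image flip"
    by (metis torus_image_comp)
  moreover have "inj ((`) (relabel q))"
    using skeleton_symmetry_relabel[OF q] by (simp add: skeleton_symmetry_def inj_on_def inj_image_eq_iff)
  ultimately have "torus_image (relabel r \<circ> flip) = torus_image flip"
    by (simp add: inj_image_eq_iff)
  then have "r = id"
    unfolding torus_image_comp by (rule torus_image_flip_rigid[OF r])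
  then show "p = q" using p_eq by simp
qed

theorem corollary1:
  "\<exists>(pairs :: (real^3) set set set set) G.
     card pairs = 6 \<and>
     (\<forall>p\<in>pairs. \<exists>P Q.
        p = {P, Q} \<and> P \<noteq> Q \<and>
        geometric_toroidal_polyhedron P \<and> geometric_toroidal_polyhedron Q \<and>
        one_skeleton P = G \<and> one_skeleton Q = G \<and>
        faces P \<inter> faces Q = {})"
proof (rule exI[of _ "torus_pair ` {p. p permutes {..<3}}"],
    rule exI[of _ "geometric_complex schlegel {\<sigma> \<in> crosspolytope_skeleton. card \<sigma> \<le> 2}"],
    intro conjI ballI)
  show "card (torus_pair ` {p. p permutes {..<3}}) = 6"
    using card_permutations[of "{..<3::nat}" 3] by (simp add: card_image[OF inj_on_torus_pair] fact_numeral)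
  fix \<P> assume "\<P> \<in> torus_pair ` {p. p permutes {..<3}}"
  then obtain p where p: "p permutes {..<3}" "\<P> = torus_pair p" by auto
  let ?P = "geometric_complex schlegel (torus_image (relabel p))"
    and ?Q = "geometric_complex schlegel (torus_image (relabel p \<circ> flip))"
  have sym: "skeleton_symmetry (relabel p)" "skeleton_symmetry (relabel p \<circ> flip)"
    using skeleton_symmetry_relabel[OF p(1)] skeleton_symmetry_flip skeleton_symmetry_comp by auto
  have disj: "faces ?P \<inter> faces ?Q = {}"
    using sym(1) by (rule faces_disjoint)
  have "{0, 1, 3} \<in> {\<sigma> \<in> cyclic_torus. card \<sigma> = 3}"
    by (simp add: cyclic_torus_simps)
  then have "relabel p ` {0, 1, 3} \<in> {\<sigma> \<in> torus_image (relabel p). card \<sigma> = 3}"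
    using card_image_inj[OF skeleton_symmetry_inj[OF sym(1)]] by (simp del: image_insert)
  then have "faces ?P \<noteq> {}"
    unfolding faces_geometric_complex[OF schlegel_realization torus_image_subset[OF sym(1)]]
    unfolding geometric_complex_def by blast
  then have "?P \<noteq> ?Q" using disj by auto
  then show "\<exists>P Q. \<P> = {P, Q} \<and> P \<noteq> Q \<and>
        geometric_toroidal_polyhedron P \<and> geometric_toroidal_polyhedron Q \<and>
        one_skeleton P = geometric_complex schlegel {\<sigma> \<in> crosspolytope_skeleton. card \<sigma> \<le> 2} \<and>
        one_skeleton Q = geometric_complex schlegel {\<sigma> \<in> crosspolytope_skeleton. card \<sigma> \<le> 2} \<and>
        faces P \<inter> faces Q = {}"
    using disj p(2) toroidal_torus_image[OF sym(1)] toroidal_torus_image[OF sym(2)]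
      one_skeleton_torus_image[OF sym(1)] one_skeleton_torus_image[OF sym(2)]
    unfolding torus_pair_def by blast
qed

end
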